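(* Consider the model $Y_i=\mathbf 1(X_i\in G)+\xi_i$, $i=1,\ldots,n$, with design $X_i=i/n$ and noise satisfying the assumptions in the context. Then the minimax risk on the class $\mathcal S_0$ satisfies $$\mathcal R_n(\mathcal S_0)\asymp_\sigma\frac1n.$$
   Context: The noise terms $\xi_1,\ldots,\xi_n$ are i.i.d. and subgaussian: for a constant $\sigma>0$, $\mathbb E[e^{u\xi_i}]\le e^{\sigma^2u^2/2}$ for all $u\in\mathbb R$. $\mathcal S_0=\{[0,\theta]:0\le\theta\le1\}$. $\mathbb E_G$ is the expectation when the unknown set is $G$; $|\cdot|$ is Lebesgue measure; $\triangle$ is symmetric difference; $\mathbf 1(\cdot)$ is the indicator function. A set estimator $\hat G_n$ is a subset of $[0,1]$ constructed from the observations $(X_1,Y_1),\ldots,(X_n,Y_n)$. For a class $\mathcal C$ of Borel subsets of $\mathbb R$, $\mathcal R_n(\mathcal C)=\inf_{\hat G_n}\sup_{G\in\mathcal C}\mathbb E_G[|G\triangle\hat G_n|]$, the infimum being over all set estimators based on $n$ observations. For sequences $A_n,B_n$ and a parameter $\vartheta$, $A_n\asymp_\vartheta B_n$ means that there are positive constants $c(\vartheta),C(\vartheta)$ depending on $\vartheta$ such that $c(\vartheta)B_n\le A_n\le C(\vartheta)B_n$ for $n$ large enough. *)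

theory Defs
  imports "HOL-Probability.Probability"
begin

(* The i.i.d. noise is represented by its common law P; the noise vector
   (xi_1, ..., xi_n) is then the identity on the product space P^n. *)
definition subgaussian_laws :: "real \<Rightarrow> real measure set" where
  "subgaussian_laws \<sigma> = {P. prob_space P \<and> sets P = sets borel \<and>
     (\<forall>u::real. integrable P (\<lambda>x. exp (u * x)) \<and>
        (LINT x|P. exp (u * x)) \<le> exp (\<sigma>\<^sup>2 * u\<^sup>2 / 2))}"

definition initial_segments :: "real set set" where
  "initial_segments = {{0..\<theta>} | \<theta>::real. 0 \<le> \<theta> \<and> \<theta> \<le> 1}"

definition sample_space :: "nat \<Rightarrow> (nat \<Rightarrow> real \<times> real) measure" where
  "sample_space n = (\<Pi>\<^sub>M i\<in>{1..n}. borel)"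

definition observations ::
    "nat \<Rightarrow> (nat \<Rightarrow> real) \<Rightarrow> real set \<Rightarrow> (nat \<Rightarrow> real) \<Rightarrow> (nat \<Rightarrow> real \<times> real)" where
  "observations n X G \<xi> = (\<lambda>i\<in>{1..n}. (X i, indicator G (X i) + \<xi> i))"

definition observation_law ::
    "nat \<Rightarrow> (nat \<Rightarrow> real) \<Rightarrow> real measure \<Rightarrow> real set \<Rightarrow> (nat \<Rightarrow> real \<times> real) measure" where
  "observation_law n X P G =
     distr (\<Pi>\<^sub>M i\<in>{1..n}. P) (sample_space n) (observations n X G)"

(* The last condition is the least that makes the expected loss meaningful for
   every Borel set G; without it the integral below would be a lower integral. *)
definition set_estimators :: "nat \<Rightarrow> ((nat \<Rightarrow> real \<times> real) \<Rightarrow> real set) set" where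
  "set_estimators n = {T.
     (\<forall>z\<in>space (sample_space n). T z \<subseteq> {0..1} \<and> T z \<in> sets lebesgue) \<and>
     (\<forall>G\<in>sets borel. (\<lambda>z. emeasure lebesgue (sym_diff G (T z)))
        \<in> borel_measurable (sample_space n))}"

definition expected_loss ::
    "nat \<Rightarrow> (nat \<Rightarrow> real) \<Rightarrow> real measure \<Rightarrow> ((nat \<Rightarrow> real \<times> real) \<Rightarrow> real set) \<Rightarrow> real set \<Rightarrow> ennreal" where
  "expected_loss n X P T G =
     (\<integral>\<^sup>+ z. emeasure lebesgue (sym_diff G (T z)) \<partial>observation_law n X P G)"

definition minimax_risk ::
    "nat \<Rightarrow> (nat \<Rightarrow> real) \<Rightarrow> real measure \<Rightarrow> real set set \<Rightarrow> ennreal" where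
  "minimax_risk n X P \<C> =
     (INF T\<in>set_estimators n. SUP G\<in>\<C>. expected_loss n X P T G)"

end

theory Submission
  imports Defs
begin

text \<open>
  Lower bound. The smallest design point is \<open>1 / n\<close>, so the data cannot distinguish the segments
  \<open>{0..0}\<close> and \<open>{0..1 / (2 * n)}\<close>: both produce the same law of the observations. By the triangle
  inequality for the symmetric difference, any estimator has losses summing to at least
  \<open>1 / (2 * n)\<close> on the two segments, hence maximal risk at least \<open>1 / (4 * n)\<close>
  (\<open>expected_loss_two_point_lower_bound\<close>, \<open>minimax_risk_segments_ge\<close>).

  Upper bound. Least squares over the segments \<open>{0..k / n}\<close> amounts to maximising
  \<open>S k = (\<Sum>i = 1..k. Y i - 1/2)\<close>. If \<open>m\<close> design points lie in the true segment, the walk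
  \<open>k \<mapsto> S k - S m\<close> drifts downwards by \<open>1/2\<close> per step on either side of \<open>m\<close>, so each step multiplies the
  expectation of \<open>exp (u * (S k - S m))\<close> by at most \<open>\<rho> = exp (\<sigma>\<^sup>2 * u\<^sup>2 / 2 - u / 2)\<close>, which is
  less than 1 for small \<open>u\<close> (\<open>exp_moment_score_le\<close>). At the maximiser \<open>S k - S m\<close> is nonnegative, so the
  distance from the maximiser to \<open>m\<close> is dominated by
  \<open>\<Sum>k\<le>n. \<bar>k - m\<bar> * exp (u * (S k - S m))\<close>. Its expectation is at most \<open>2 * (\<Sum>d. d * \<rho> ^ d)\<close>, a
  constant depending on \<open>\<sigma>\<close> alone once \<open>u\<close> is chosen as a function of \<open>\<sigma>\<close>; dividing by the grid size
  \<open>n\<close> gives the rate (\<open>expected_loss_segment_estimator_le\<close>).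
\<close>

section \<open>The least squares estimator\<close>

text \<open>
  The sum of squared residuals for a fitted segment that contains exactly the first \<open>k\<close> design points is
  a constant minus twice this score, so maximising the score is least squares.
\<close>

definition score :: "(nat \<Rightarrow> real \<times> real) \<Rightarrow> nat \<Rightarrow> real" where
  "score z k = (\<Sum>i\<in>{1..k}. snd (z i) - 1/2)"

text \<open>
  Ties are broken by taking the smallest maximiser, which makes the index a measurable function of the
  data.
\<close>

definition best_index :: "nat \<Rightarrow> (nat \<Rightarrow> real \<times> real) \<Rightarrow> nat" where
  "best_index n z = (LEAST k. k \<le> n \<and> (\<forall>j\<in>{..n}. score z j \<le> score z k))"

definition segment_estimator :: "nat \<Rightarrow> (nat \<Rightarrow> real \<times> real) \<Rightarrow> real set" where
  "segment_estimator n z = {0..real (best_index n z) / real n}"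

lemma best_index_maximises:
  "best_index n z \<le> n \<and> (\<forall>j\<in>{..n}. score z j \<le> score z (best_index n z))"
proof -
  have "Max (score z ` {..n}) \<in> score z ` {..n}"
    by (intro Max_in) auto
  then obtain k where k: "k \<le> n" "score z k = Max (score z ` {..n})"
    by (metis atMost_iff imageE)
  have "k \<le> n \<and> (\<forall>j\<in>{..n}. score z j \<le> score z k)"
    using k by simp
  then show ?thesis
    unfolding best_index_def by (rule LeastI)
qed

lemma measurable_score:
  assumes "k \<le> n"
  shows "(\<lambda>z. score z k) \<in> borel_measurable (sample_space n)"
  unfolding score_def
proof (intro borel_measurable_sum borel_measurable_diff borel_measurable_const)
  fix i assume "i \<in> {1..k}"
  then have i: "i \<in> {1..n}" using assms by auto
  have snd: "(snd :: real \<times> real \<Rightarrow> real) \<in> borel_measurable borel"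
    by (intro borel_measurable_continuous_onI continuous_intros)
  have "(\<lambda>z. z i) \<in> sample_space n \<rightarrow>\<^sub>M borel"
    unfolding sample_space_def using i by (rule measurable_component_singleton)
  from measurable_compose[OF this snd]
  show "(\<lambda>z. snd (z i)) \<in> borel_measurable (sample_space n)" .
qed

lemma measurable_best_index:
  "best_index n \<in> sample_space n \<rightarrow>\<^sub>M count_space UNIV"
  unfolding best_index_def
proof (rule measurable_Least)
  fix k
  show "Measurable.pred (sample_space n)
          (\<lambda>z. k \<le> n \<and> (\<forall>j\<in>{..n}. score z j \<le> score z k))"
  proof (cases "k \<le> n")
    case True
    have "Measurable.pred (sample_space n) (\<lambda>z. \<forall>j\<in>{..n}. score z j \<le> score z k)"
    proof (rule pred_intros_finite)
      fix j assume "j \<in> {..n}"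
      then show "Measurable.pred (sample_space n) (\<lambda>z. score z j \<le> score z k)"
        using True by (auto simp: pred_def intro!: borel_measurable_le measurable_score)
    qed simp
    with True show ?thesis by simp
  qed simp
qed

lemma segment_estimator_in_set_estimators:
  assumes "n > 0"
  shows "segment_estimator n \<in> set_estimators n"
proof -
  have "(\<lambda>z. emeasure lebesgue (sym_diff G (segment_estimator n z)))
          \<in> borel_measurable (sample_space n)" for G
    unfolding segment_estimator_def
    (* The loss factors through an integer-valued statistic, so any function of it is measurable. *)
    by (rule measurable_compose[OF measurable_best_index,
          where g = "\<lambda>k. emeasure lebesgue (sym_diff G {0..real k / real n})"]) simp
  moreover have "segment_estimator n z \<subseteq> {0..1}" for z
    using best_index_maximises[of n z] assms
    by (auto simp: segment_estimator_def field_simps)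
  ultimately show ?thesis
    by (auto simp: set_estimators_def segment_estimator_def simp del: emeasure_completion)
qed

lemma emeasure_sym_diff_segments_le:
  fixes a b :: real
  shows "emeasure lebesgue (sym_diff {0..a} {0..b}) \<le> ennreal \<bar>a - b\<bar>"
proof -
  have "emeasure lebesgue (sym_diff {0..a} {0..b}) \<le> emeasure lebesgue {min a b..max a b}"
    by (intro emeasure_mono) auto
  also have "\<dots> = ennreal \<bar>a - b\<bar>"
    by (simp add: emeasure_lborel_Icc_eq max_def min_def abs_if)
  finally show ?thesis .
qed

section \<open>Exponential moments of the score\<close>

lemma measurable_observations:
  assumes "sets P = sets borel"
  shows "observations n X G \<in> (\<Pi>\<^sub>M i\<in>{1..n}. P) \<rightarrow>\<^sub>M sample_space n"
  unfolding observations_def sample_space_def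
proof (rule measurable_restrict)
  fix i assume i: "i \<in> {1..n}"
  have [measurable]: "(\<lambda>\<xi>. \<xi> i) \<in> (\<Pi>\<^sub>M i\<in>{1..n}. P) \<rightarrow>\<^sub>M borel"
    using measurable_component_singleton[OF i, of "\<lambda>_. P"]
    by (simp add: measurable_cong_sets[OF refl assms])
  show "(\<lambda>\<xi>. (X i, indicator G (X i) + \<xi> i)) \<in> (\<Pi>\<^sub>M i\<in>{1..n}. P) \<rightarrow>\<^sub>M borel"
    by measurable
qed

text \<open>
  The exponential of the sum is a product of functions of separate independent coordinates, so the integral
  factorises; the coordinates outside \<open>D\<close> contribute the total mass 1.
\<close>

lemma exp_moment_noise_sum_le:
  assumes P: "P \<in> subgaussian_laws \<sigma>" and D: "D \<subseteq> I" and I: "finite I"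
  shows "(\<integral>\<^sup>+ \<xi>. ennreal (exp (\<Sum>i\<in>D. v * \<xi> i - a)) \<partial>(\<Pi>\<^sub>M i\<in>I. P))
           \<le> ennreal (exp (\<sigma>\<^sup>2 * v\<^sup>2 / 2 - a) ^ card D)"
proof -
  interpret prob_space P using P by (simp add: subgaussian_laws_def)
  interpret product_sigma_finite "\<lambda>_. P" ..
  have sets [measurable_cong]: "sets P = sets borel"
    and int: "integrable P (\<lambda>x. exp (v * x))"
    and le: "(LINT x|P. exp (v * x)) \<le> exp (\<sigma>\<^sup>2 * v\<^sup>2 / 2)"
    using P by (auto simp: subgaussian_laws_def)
  let ?f = "\<lambda>i x. if i \<in> D then ennreal (exp (v * x - a)) else 1"
  have "finite D" using D I finite_subset by blast
  have "(\<integral>\<^sup>+ \<xi>. ennreal (exp (\<Sum>i\<in>D. v * \<xi> i - a)) \<partial>(\<Pi>\<^sub>M i\<in>I. P))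
      = (\<integral>\<^sup>+ \<xi>. (\<Prod>i\<in>I. ?f i (\<xi> i)) \<partial>(\<Pi>\<^sub>M i\<in>I. P))"
  proof (intro nn_integral_cong)
    fix \<xi> :: "'a \<Rightarrow> real"
    have "(\<Prod>i\<in>I. ?f i (\<xi> i)) = (\<Prod>i\<in>D. ennreal (exp (v * \<xi> i - a)))"
      using D I by (subst prod.inter_restrict[symmetric]) (auto simp: Int_absorb1)
    then show "ennreal (exp (\<Sum>i\<in>D. v * \<xi> i - a)) = (\<Prod>i\<in>I. ?f i (\<xi> i))"
      using \<open>finite D\<close> by (simp add: exp_sum prod_ennreal)
  qed
  also have "\<dots> = (\<Prod>i\<in>I. \<integral>\<^sup>+ x. ?f i x \<partial>P)"
    using I by (intro product_nn_integral_prod) auto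
  also have "\<dots> = (\<Prod>i\<in>I. if i \<in> D then \<integral>\<^sup>+ x. ennreal (exp (v * x - a)) \<partial>P else 1)"
    by (intro prod.cong) (auto simp: emeasure_space_1)
  also have "\<dots> = (\<Prod>i\<in>D. \<integral>\<^sup>+ x. ennreal (exp (v * x - a)) \<partial>P)"
    using D I by (subst prod.inter_restrict[symmetric]) (auto simp: Int_absorb1)
  also have "(\<integral>\<^sup>+ x. ennreal (exp (v * x - a)) \<partial>P) = ennreal ((LINT x|P. exp (v * x)) / exp a)"
    using int by (simp add: exp_diff nn_integral_eq_integral)
  also have "(\<Prod>i\<in>D. ennreal ((LINT x|P. exp (v * x)) / exp a))
      = ennreal (((LINT x|P. exp (v * x)) / exp a) ^ card D)"
    by (simp add: ennreal_power)
  also have "\<dots> \<le> ennreal (exp (\<sigma>\<^sup>2 * v\<^sup>2 / 2 - a) ^ card D)"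
    using le by (intro ennreal_leI power_mono) (auto simp: exp_diff divide_right_mono)
  finally show ?thesis .
qed

lemma indicator_segment_design:
  assumes "n > 0" "0 \<le> \<theta>"
  shows "indicator {0..\<theta>} (real i / real n) = (if i \<le> nat \<lfloor>real n * \<theta>\<rfloor> then 1 else (0::real))"
proof -
  have "real i / real n \<le> \<theta> \<longleftrightarrow> real i \<le> real n * \<theta>"
    using assms by (simp add: field_simps)
  also have "\<dots> \<longleftrightarrow> i \<le> nat \<lfloor>real n * \<theta>\<rfloor>"
    using assms by (simp add: le_nat_iff le_floor_iff)
  finally show ?thesis by (simp add: indicator_def)
qed

text \<open>
  The increment of the score between \<open>m\<close> and \<open>k\<close> is a sum of \<open>\<bar>k - m\<bar>\<close> terms: \<open>\<xi> i - 1/2\<close> to the right of \<open>m\<close>,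
  where the signal vanishes, and \<open>-(\<xi> i + 1/2)\<close> to the left, where it equals 1. The bound on the
  exponential moments is even in its argument, so both sides decay at the same geometric rate.
\<close>

lemma exp_moment_score_le:
  fixes n :: nat and \<theta> \<sigma> :: real
  assumes P: "P \<in> subgaussian_laws \<sigma>" and n: "n > 0" and \<theta>: "0 \<le> \<theta>" "\<theta> \<le> 1" and k: "k \<le> n"
    and u: "u \<ge> 0"
  defines "m \<equiv> nat \<lfloor>real n * \<theta>\<rfloor>"
    and "obs \<equiv> observations n (\<lambda>i. real i / real n) {0..\<theta>}"
  shows "(\<integral>\<^sup>+ \<xi>. ennreal (exp (u * (score (obs \<xi>) k - score (obs \<xi>) m))) \<partial>(\<Pi>\<^sub>M i\<in>{1..n}. P))
           \<le> ennreal (exp (\<sigma>\<^sup>2 * u\<^sup>2 / 2 - u / 2) ^ nat \<bar>int k - int m\<bar>)"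
proof -
  have "real n * \<theta> \<le> real n" using \<theta> by (simp add: mult_left_le)
  then have m: "m \<le> n" unfolding m_def by linarith
  have snd_obs: "snd (obs \<xi> i) = (if i \<le> m then 1 else 0) + \<xi> i" if "1 \<le> i" "i \<le> n" for \<xi> i
    using that n \<theta> by (simp add: obs_def observations_def m_def indicator_segment_design)
  have score_diff: "score z l - score z j = (\<Sum>i\<in>{j<..l}. snd (z i) - 1/2)" if "j \<le> l" for z j l
  proof -
    have "{1..l} = {1..j} \<union> {j<..l}" using that by auto
    then have "score z l = score z j + (\<Sum>i\<in>{j<..l}. snd (z i) - 1/2)"
      unfolding score_def by (simp only:) (rule sum.union_disjoint, auto)
    then show ?thesis by simp
  qed
  show ?thesis
  proof (cases "m \<le> k")
    case True
    have "u * (score (obs \<xi>) k - score (obs \<xi>) m) = (\<Sum>i\<in>{m<..k}. u * \<xi> i - u / 2)" for \<xi>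
      unfolding score_diff[OF True] sum_distrib_left
      using k by (intro sum.cong) (auto simp: snd_obs algebra_simps)
    moreover have "card {m<..k} = nat \<bar>int k - int m\<bar>" using True by simp
    ultimately show ?thesis
      using exp_moment_noise_sum_le[OF P, of "{m<..k}" "{1..n}" u "u/2"] k by (simp add: subset_iff)
  next
    case False
    then have km: "k \<le> m" by simp
    have "u * (score (obs \<xi>) k - score (obs \<xi>) m) = (\<Sum>i\<in>{k<..m}. (-u) * \<xi> i - u / 2)" for \<xi>
    proof -
      have "u * (score (obs \<xi>) k - score (obs \<xi>) m) = (-u) * (score (obs \<xi>) m - score (obs \<xi>) k)"
        by (simp add: algebra_simps)
      also have "\<dots> = (\<Sum>i\<in>{k<..m}. (-u) * \<xi> i - u / 2)"
        unfolding score_diff[OF km] sum_distrib_left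
        using m by (intro sum.cong) (auto simp: snd_obs algebra_simps)
      finally show ?thesis .
    qed
    moreover have "card {k<..m} = nat \<bar>int k - int m\<bar>" using km by simp
    ultimately show ?thesis
      using exp_moment_noise_sum_le[OF P, of "{k<..m}" "{1..n}" "-u" "u/2"] m by (simp add: subset_iff)
  qed
qed

section \<open>Upper bound for the risk\<close>

text \<open>Every distance \<open>d\<close> occurs at most twice, once on each side of \<open>m\<close>.\<close>

lemma sum_distance_weights_le:
  fixes f :: "nat \<Rightarrow> real"
  assumes f: "summable f" "\<And>d. 0 \<le> f d"
  shows "(\<Sum>k\<le>n. f (nat \<bar>int k - int m\<bar>)) \<le> 2 * suminf f"
proof -
  let ?d = "\<lambda>k. nat \<bar>int k - int m\<bar>"
  have half: "(\<Sum>k\<in>A. f (?d k)) \<le> suminf f" if "inj_on ?d A" "finite A" for A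
  proof -
    have "(\<Sum>k\<in>A. f (?d k)) = sum f (?d ` A)"
      using that by (simp add: sum.reindex)
    also have "\<dots> \<le> suminf f"
      using f that by (intro sum_le_suminf) auto
    finally show ?thesis .
  qed
  have "{..n} = {k. k \<le> n \<and> k \<le> m} \<union> {k. k \<le> n \<and> m < k}" by auto
  then have "(\<Sum>k\<le>n. f (?d k))
      = (\<Sum>k | k \<le> n \<and> k \<le> m. f (?d k)) + (\<Sum>k | k \<le> n \<and> m < k. f (?d k))"
    by (simp only:) (intro sum.union_disjoint, auto)
  also have "\<dots> \<le> suminf f + suminf f"
    by (intro add_mono half) (auto simp: inj_on_def)
  finally show ?thesis by simp
qed

lemma summable_linear_times_geometric:
  fixes \<rho> :: real
  assumes "0 \<le> \<rho>" "\<rho> < 1"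
  shows "summable (\<lambda>d. real d * \<rho> ^ d)"
proof -
  have "summable (\<lambda>d. real (Suc d) * \<rho> ^ d)"
    using geometric_deriv_sums[of \<rho>] assms by (simp add: sums_iff)
  from summable_mult2[OF this, of \<rho>]
  have "summable (\<lambda>d. real (Suc d) * \<rho> ^ Suc d)"
    by (simp add: mult_ac)
  then show ?thesis by (simp only: summable_Suc_iff[of "\<lambda>d. real d * \<rho> ^ d"])
qed

lemma ennreal_one_plus_sum_times:
  fixes f g :: "'a \<Rightarrow> real"
  assumes "\<And>k. 0 \<le> f k" "\<And>k. 0 \<le> g k" "0 \<le> c"
  shows "ennreal ((1 + (\<Sum>k\<in>A. f k * g k)) * c)
    = (1 + (\<Sum>k\<in>A. ennreal (f k) * ennreal (g k))) * ennreal c"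
  using assms by (simp add: ennreal_mult sum_nonneg flip: sum_ennreal)

lemma (in prob_space) nn_integral_one_plus_sum_times:
  fixes a :: "'b \<Rightarrow> ennreal"
  assumes "\<And>k. k \<in> A \<Longrightarrow> E k \<in> borel_measurable M"
  shows "(\<integral>\<^sup>+ x. (1 + (\<Sum>k\<in>A. a k * E k x)) * c \<partial>M) = (1 + (\<Sum>k\<in>A. a k * (\<integral>\<^sup>+ x. E k x \<partial>M))) * c"
  using assms
  by (simp add: nn_integral_multc nn_integral_add nn_integral_sum nn_integral_cmult emeasure_space_1)

text \<open>
  The law of the maximiser is never computed. Summing over all candidate indices, with an exponential
  weight that is at least 1 at the maximiser, turns its distance to \<open>m\<close> into a sum of explicit moments.
  The summand 1 in the constant accounts for the rounding of \<open>\<theta>\<close> to the grid.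
\<close>

lemma expected_loss_segment_estimator_le:
  fixes n :: nat and \<theta> \<sigma> u :: real
  assumes P: "P \<in> subgaussian_laws \<sigma>" and n: "n > 0" and \<theta>: "0 \<le> \<theta>" "\<theta> \<le> 1"
    and u: "u \<ge> 0"
  defines "\<rho> \<equiv> exp (\<sigma>\<^sup>2 * u\<^sup>2 / 2 - u / 2)"
  assumes \<rho>: "\<rho> < 1"
  shows "expected_loss n (\<lambda>i. real i / real n) P (segment_estimator n) {0..\<theta>}
           \<le> ennreal ((1 + 2 * (\<Sum>d. real d * \<rho> ^ d)) * (1 / real n))"
proof -
  have sets: "sets P = sets borel" using P by (simp add: subgaussian_laws_def)
  interpret P: prob_space P using P by (simp add: subgaussian_laws_def)
  let ?N = "\<Pi>\<^sub>M i\<in>{1..n}. P"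
  interpret N: prob_space ?N by (intro prob_space_PiM) unfold_locales
  let ?X = "\<lambda>i. real i / real n"
  let ?obs = "observations n ?X {0..\<theta>}"
  define m where "m = nat \<lfloor>real n * \<theta>\<rfloor>"
  let ?d = "\<lambda>k. nat \<bar>int k - int m\<bar>"
  let ?w = "\<lambda>\<xi> k. real (?d k) * exp (u * (score (?obs \<xi>) k - score (?obs \<xi>) m))"
  have "real n * \<theta> \<le> real n" using \<theta> by (simp add: mult_left_le)
  then have m: "m \<le> n" unfolding m_def by linarith
  note obs = measurable_observations[OF sets, of n ?X "{0..\<theta>}"]
  have measurable_ennreal_exp_score:
    "(\<lambda>\<xi>. ennreal (exp (u * (score (?obs \<xi>) k - score (?obs \<xi>) m)))) \<in> borel_measurable ?N"
    if "k \<in> {..n}" for k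
  proof -
    note [measurable] = measurable_compose[OF obs measurable_score[OF m]]
    from that have "k \<le> n" by simp
    note [measurable] = measurable_compose[OF obs measurable_score[OF this]]
    show ?thesis by measurable
  qed
  have pointwise: "emeasure lebesgue (sym_diff {0..\<theta>} (segment_estimator n (?obs \<xi>)))
      \<le> ennreal ((1 + (\<Sum>k\<le>n. ?w \<xi> k)) * (1 / real n))" for \<xi>
  proof -
    let ?k = "best_index n (?obs \<xi>)"
    have k: "?k \<le> n" "score (?obs \<xi>) m \<le> score (?obs \<xi>) ?k"
      using best_index_maximises[of n "?obs \<xi>"] m by auto
    have "\<bar>real n * \<theta> - real m\<bar> \<le> 1"
      unfolding m_def using \<theta> by (simp, linarith)
    then have "\<bar>real n * \<theta> - real ?k\<bar> \<le> 1 + real (?d ?k)"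
      by linarith
    moreover have "\<bar>\<theta> - real ?k / real n\<bar> = \<bar>real n * \<theta> - real ?k\<bar> / real n"
      using n by (simp add: field_simps flip: abs_mult)
    ultimately have "\<bar>\<theta> - real ?k / real n\<bar> \<le> (1 + real (?d ?k)) * (1 / real n)"
      using n by (simp add: divide_right_mono)
    (* The weight at the maximiser is at least 1 because its score is no smaller than that of m. *)
    also have "real (?d ?k) \<le> ?w \<xi> ?k"
      using k u by (simp add: mult_le_cancel_left1)
    also have "?w \<xi> ?k \<le> (\<Sum>k\<le>n. ?w \<xi> k)"
      using k(1) by (intro member_le_sum) auto
    finally have "\<bar>\<theta> - real ?k / real n\<bar> \<le> (1 + (\<Sum>k\<le>n. ?w \<xi> k)) * (1 / real n)"
      by (simp add: divide_right_mono)
    then show ?thesis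
      using emeasure_sym_diff_segments_le[of \<theta> "real ?k / real n"]
      unfolding segment_estimator_def by (meson ennreal_leI order_trans)
  qed
  have summable: "summable (\<lambda>d. real d * \<rho> ^ d)"
    using \<rho> by (intro summable_linear_times_geometric) (auto simp: \<rho>_def)
  have "expected_loss n ?X P (segment_estimator n) {0..\<theta>}
      = (\<integral>\<^sup>+ \<xi>. emeasure lebesgue (sym_diff {0..\<theta>} (segment_estimator n (?obs \<xi>))) \<partial>?N)"
    unfolding expected_loss_def observation_law_def
    using segment_estimator_in_set_estimators[OF n]
    by (intro nn_integral_distr obs) (auto simp: set_estimators_def)
  also have "\<dots> \<le> (\<integral>\<^sup>+ \<xi>. ennreal ((1 + (\<Sum>k\<le>n. ?w \<xi> k)) * (1 / real n)) \<partial>?N)"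
    by (intro nn_integral_mono pointwise)
  also have "\<dots> = (\<integral>\<^sup>+ \<xi>. (1 + (\<Sum>k\<le>n. ennreal (real (?d k)) *
        ennreal (exp (u * (score (?obs \<xi>) k - score (?obs \<xi>) m))))) * ennreal (1 / real n) \<partial>?N)"
    by (intro nn_integral_cong ennreal_one_plus_sum_times) auto
  also have "\<dots> = (1 + (\<Sum>k\<le>n. ennreal (real (?d k)) *
        (\<integral>\<^sup>+ \<xi>. ennreal (exp (u * (score (?obs \<xi>) k - score (?obs \<xi>) m))) \<partial>?N))) * ennreal (1 / real n)"
    by (intro N.nn_integral_one_plus_sum_times measurable_ennreal_exp_score) auto
  also have "\<dots> \<le> (1 + (\<Sum>k\<le>n. ennreal (real (?d k)) * ennreal (\<rho> ^ ?d k))) * ennreal (1 / real n)"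
    unfolding \<rho>_def m_def
    by (intro mult_right_mono add_mono sum_mono mult_left_mono exp_moment_score_le[OF P n \<theta> _ u]) auto
  also have "\<dots> = ennreal ((1 + (\<Sum>k\<le>n. real (?d k) * \<rho> ^ ?d k)) * (1 / real n))"
    by (intro ennreal_one_plus_sum_times[symmetric]) (auto simp: \<rho>_def)
  also have "\<dots> \<le> ennreal ((1 + 2 * (\<Sum>d. real d * \<rho> ^ d)) * (1 / real n))"
    using sum_distance_weights_le[OF summable, where n = n and m = m]
    by (intro ennreal_leI mult_right_mono) (auto simp: \<rho>_def)
  finally show ?thesis .
qed

section \<open>Lower bound for the risk\<close>

lemma emeasure_lebesgue_sym_diff_triangle:
  assumes "A \<in> sets lebesgue" "B \<in> sets lebesgue" "T \<in> sets lebesgue"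
  shows "emeasure lebesgue (sym_diff A B)
      \<le> emeasure lebesgue (sym_diff A T) + emeasure lebesgue (sym_diff B T)"
proof -
  have "emeasure lebesgue (sym_diff A B) \<le> emeasure lebesgue (sym_diff A T \<union> sym_diff B T)"
    using assms by (intro emeasure_mono) auto
  also have "\<dots> \<le> emeasure lebesgue (sym_diff A T) + emeasure lebesgue (sym_diff B T)"
    using assms by (intro emeasure_subadditive) auto
  finally show ?thesis .
qed

text \<open>
  Two sets that contain the same design points give the same observations for every noise vector, hence the
  same law, so both expected losses are integrals against one probability measure and the triangle
  inequality can be integrated.
\<close>

lemma expected_loss_two_point_lower_bound:
  assumes P: "prob_space P" "sets P = sets borel" and T: "T \<in> set_estimators n"
    and GH: "G \<in> sets borel" "H \<in> sets borel"
    and indist: "\<And>i. i \<in> {1..n} \<Longrightarrow> X i \<in> G \<longleftrightarrow> X i \<in> H"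
  shows "emeasure lebesgue (sym_diff G H) \<le> expected_loss n X P T G + expected_loss n X P T H"
proof -
  have obs_eq: "observations n X H = observations n X G"
    using indist by (auto simp: observations_def indicator_def fun_eq_iff restrict_def)
  let ?L = "observation_law n X P G"
  have "prob_space (\<Pi>\<^sub>M i\<in>{1..n}. P)" using P by (intro prob_space_PiM)
  then interpret L: prob_space ?L
    unfolding observation_law_def
    by (intro prob_space.prob_space_distr measurable_observations P)
  have sets_L: "sets ?L = sets (sample_space n)" by (simp add: observation_law_def)
  have meas: "(\<lambda>z. emeasure lebesgue (sym_diff A (T z))) \<in> borel_measurable ?L"
    if "A \<in> sets borel" for A
    using T that by (simp add: set_estimators_def measurable_cong_sets[OF sets_L refl])
  have "emeasure lebesgue (sym_diff G H) = (\<integral>\<^sup>+ z. emeasure lebesgue (sym_diff G H) \<partial>?L)"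
    by (simp add: L.emeasure_space_1)
  also have "\<dots> \<le> (\<integral>\<^sup>+ z. emeasure lebesgue (sym_diff G (T z)) + emeasure lebesgue (sym_diff H (T z)) \<partial>?L)"
  proof (intro nn_integral_mono emeasure_lebesgue_sym_diff_triangle)
    fix z assume "z \<in> space ?L"
    then show "T z \<in> sets lebesgue"
      using T sets_eq_imp_space_eq[OF sets_L] by (auto simp: set_estimators_def)
  qed (use GH in auto)
  also have "\<dots> = expected_loss n X P T G + expected_loss n X P T H"
    unfolding expected_loss_def observation_law_def obs_eq
    unfolding observation_law_def[symmetric]
    using GH by (intro nn_integral_add meas)
  finally show ?thesis .
qed

lemma minimax_risk_segments_ge:
  assumes P: "prob_space P" "sets P = sets borel" and n: "n > 0"
  shows "ennreal (1/4 * (1 / real n)) \<le> minimax_risk n (\<lambda>i. real i / real n) P initial_segments"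
  unfolding minimax_risk_def
proof (rule INF_greatest)
  fix T assume T: "T \<in> set_estimators n"
  let ?X = "\<lambda>i. real i / real n"
  let ?S = "SUP G\<in>initial_segments. expected_loss n ?X P T G"
  (* Any right end point below 1 / n would leave the observations unchanged. *)
  let ?h = "1 / (2 * real n)"
  have seg: "{0..0} \<in> initial_segments" "{0..?h} \<in> initial_segments"
    using n unfolding initial_segments_def by (force, intro CollectI exI[of _ ?h]) simp
  have "sym_diff {0..0} {0..?h} = {0<..?h}" by auto
  then have "ennreal ?h = emeasure lebesgue (sym_diff {0..0} {0..?h})"
    by (simp add: emeasure_lborel_Ioc)
  also have "\<dots> \<le> expected_loss n ?X P T {0..0} + expected_loss n ?X P T {0..?h}"
    by (rule expected_loss_two_point_lower_bound[OF P T]) (use n in \<open>auto simp: field_simps\<close>)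
  also have "\<dots> \<le> ?S + ?S"
    by (intro add_mono SUP_upper seg)
  also have "?S + ?S = 2 * ?S" by (rule mult_2[symmetric])
  also have "ennreal ?h = ennreal 2 * ennreal (1/4 * (1 / real n))"
    by (subst ennreal_mult[symmetric]) auto
  finally have "2 * ennreal (1/4 * (1 / real n)) \<le> 2 * ?S"
    by (simp only: ennreal_numeral)
  then show "ennreal (1/4 * (1 / real n)) \<le> ?S"
    by (subst (asm) ennreal_mult_le_mult_iff) auto
qed

section \<open>The minimax rate\<close>

theorem theorem4:
  fixes \<sigma> :: real
  assumes "\<sigma> > 0"
  shows "\<exists>c::real. \<exists>C::real. c > 0 \<and> C > 0 \<and>
    (\<forall>\<^sub>F n in sequentially. \<forall>P\<in>subgaussian_laws \<sigma>.
       ennreal (c * (1 / real n)) \<le> minimax_risk n (\<lambda>i. real i / real n) P initial_segments \<and>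
       minimax_risk n (\<lambda>i. real i / real n) P initial_segments \<le> ennreal (C * (1 / real n)))"
proof -
  (* This value minimises the exponent in \<rho>, making it - 1 / (8 * \<sigma>\<^sup>2). *)
  define u where "u = 1 / (2 * \<sigma>\<^sup>2)"
  define \<rho> where "\<rho> = exp (\<sigma>\<^sup>2 * u\<^sup>2 / 2 - u / 2)"
  define C where "C = 1 + 2 * (\<Sum>d. real d * \<rho> ^ d)"
  have u: "u > 0" using assms by (simp add: u_def)
  have "\<sigma>\<^sup>2 * u\<^sup>2 = (\<sigma>\<^sup>2 * u) * u" by (simp add: power2_eq_square)
  also have "\<sigma>\<^sup>2 * u = 1 / 2" using assms by (simp add: u_def)
  finally have "\<sigma>\<^sup>2 * u\<^sup>2 / 2 - u / 2 = - u / 4" by simp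
  then have \<rho>: "\<rho> < 1" using u by (simp add: \<rho>_def)
  have \<rho>_nonneg: "\<rho> \<ge> 0" by (simp add: \<rho>_def)
  have "(\<Sum>d. real d * \<rho> ^ d) \<ge> 0"
    using summable_linear_times_geometric[OF \<rho>_nonneg \<rho>] \<rho>_nonneg by (intro suminf_nonneg) auto
  then have C: "C > 0" by (simp add: C_def)
  have upper: "minimax_risk n (\<lambda>i. real i / real n) P initial_segments \<le> ennreal (C * (1 / real n))"
    if P: "P \<in> subgaussian_laws \<sigma>" and n: "n > 0" for P n
  proof -
    have "minimax_risk n (\<lambda>i. real i / real n) P initial_segments
        \<le> (SUP G\<in>initial_segments. expected_loss n (\<lambda>i. real i / real n) P (segment_estimator n) G)"
      unfolding minimax_risk_def by (rule INF_lower[OF segment_estimator_in_set_estimators[OF n]])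
    also have "\<dots> \<le> ennreal (C * (1 / real n))"
    proof (rule SUP_least)
      fix G assume "G \<in> initial_segments"
      then obtain \<theta> where G: "G = {0..\<theta>}" and \<theta>: "0 \<le> \<theta>" "\<theta> \<le> 1"
        by (auto simp: initial_segments_def)
      show "expected_loss n (\<lambda>i. real i / real n) P (segment_estimator n) G \<le> ennreal (C * (1 / real n))"
        unfolding G C_def \<rho>_def
        by (rule expected_loss_segment_estimator_le[OF P n \<theta>])
          (use u \<rho> in \<open>auto simp: \<rho>_def\<close>)
    qed
    finally show ?thesis .
  qed
  have lower: "ennreal (1/4 * (1 / real n)) \<le> minimax_risk n (\<lambda>i. real i / real n) P initial_segments"
    if "P \<in> subgaussian_laws \<sigma>" "n > 0" for P n
    using that by (intro minimax_risk_segments_ge) (auto simp: subgaussian_laws_def)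
  show ?thesis
  proof (intro exI conjI)
    show "(1/4::real) > 0" by simp
    show "C > 0" by (rule C)
    show "\<forall>\<^sub>F n in sequentially. \<forall>P\<in>subgaussian_laws \<sigma>.
       ennreal (1/4 * (1 / real n)) \<le> minimax_risk n (\<lambda>i. real i / real n) P initial_segments \<and>
       minimax_risk n (\<lambda>i. real i / real n) P initial_segments \<le> ennreal (C * (1 / real n))"
      using eventually_gt_at_top[of "0::nat"]
      by eventually_elim (use lower upper in blast)
  qed
qed

end
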